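(* For every field $K$, every outer commutator word $w$, and every integer $n\ge 2$, the equality $\operatorname{wid}(T_n(K),w)=1$ holds in the group $T_n(K)$ of triangular matrices.
   Context: $\mathbb N$ denotes the set of positive integers. $T_n(K)$ is the group of invertible upper triangular $n\times n$ matrices over the field $K$. The commutator is $[x,y]=x^{-1}y^{-1}xy$. An outer commutator word is a group word obtained from a finite sequence of distinct variables $x_1,x_2,\dots,x_r$ (each used exactly once) using only group commutators, with an arbitrary arrangement of commutator brackets; for instance $[[x_1,x_2],[x_3,x_4]]$ is an outer commutator word, while $[x_1,x_2][x_3,x_4]$ and $[[x_1,x_2],[x_1,x_3]]$ are not. For a group $G$ and a group word $w$, the verbal subgroup $v(G,w)$ is the subgroup of $G$ generated by all values of $w$ on $G$ (all elements obtained by substituting elements of $G$ for the variables of $w$). The width $\operatorname{wid}(G,w)$ is the smallest number $m$ in $\mathbb N\cup\{+\infty\}$ such that every element of $v(G,w)$ is the product of at most $m$ elements, each of which is a value of $w$ on $G$ or the inverse of such a value (in particular, the width of a trivial verbal subgroup is $1$). *)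

theory Defs
  imports
    "Jordan_Normal_Form.Matrix"
    "HOL-Algebra.Generated_Groups"
    "HOL-Library.Extended_Nat"
begin

text \<open>A word is a list of letters; \<open>(x, True)\<close> stands for the variable with index \<open>x\<close>,
  \<open>(x, False)\<close> for its formal inverse.\<close>

type_synonym gword = "(nat \<times> bool) list"

definition word_inv :: "gword \<Rightarrow> gword" where
  "word_inv w = rev (map (\<lambda>(x, b). (x, \<not> b)) w)"

definition word_comm :: "gword \<Rightarrow> gword \<Rightarrow> gword" where
  "word_comm u v = word_inv u @ word_inv v @ u @ v"

text \<open>\<open>commutator_bracketing xs w\<close>: \<open>w\<close> arises from the sequence of variables \<open>xs\<close>, taken in this
  order, by some arrangement of commutator brackets. A single variable without any bracket
  is included.\<close>

inductive commutator_bracketing :: "nat list \<Rightarrow> gword \<Rightarrow> bool" where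
  variable: "commutator_bracketing [x] [(x, True)]"
| commutator: "commutator_bracketing xs u \<Longrightarrow> commutator_bracketing ys v \<Longrightarrow>
    commutator_bracketing (xs @ ys) (word_comm u v)"

definition outer_commutator_word :: "gword \<Rightarrow> bool" where
  "outer_commutator_word w \<longleftrightarrow> (\<exists>xs. distinct xs \<and> commutator_bracketing xs w)"

definition list_prod :: "('a, 'b) monoid_scheme \<Rightarrow> 'a list \<Rightarrow> 'a" where
  "list_prod G gs = foldr (\<lambda>g h. g \<otimes>\<^bsub>G\<^esub> h) gs \<one>\<^bsub>G\<^esub>"

definition word_value :: "('a, 'b) monoid_scheme \<Rightarrow> (nat \<Rightarrow> 'a) \<Rightarrow> gword \<Rightarrow> 'a" where
  "word_value G \<sigma> w = list_prod G (map (\<lambda>(x, b). if b then \<sigma> x else inv\<^bsub>G\<^esub> (\<sigma> x)) w)"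

definition word_values :: "('a, 'b) monoid_scheme \<Rightarrow> gword \<Rightarrow> 'a set" where
  "word_values G w = {word_value G \<sigma> w | \<sigma>. \<sigma> \<in> UNIV \<rightarrow> carrier G}"

definition verbal_subgroup :: "('a, 'b) monoid_scheme \<Rightarrow> gword \<Rightarrow> 'a set" where
  "verbal_subgroup G w = generate G (word_values G w)"

text \<open>The condition \<open>1 \<le> m\<close> makes \<open>m\<close> range over the positive integers and infinity. In a group,
  \<open>m = \<infinity>\<close> always satisfies the body, so the least element exists.\<close>

definition wid :: "('a, 'b) monoid_scheme \<Rightarrow> gword \<Rightarrow> enat" where
  "wid G w = (LEAST m. 1 \<le> m \<and>
     (\<forall>g \<in> verbal_subgroup G w. \<exists>gs.
        enat (length gs) \<le> m \<and>
        set gs \<subseteq> word_values G w \<union> m_inv G ` word_values G w \<and>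
        g = list_prod G gs))"

definition triangular_group :: "'k :: field itself \<Rightarrow> nat \<Rightarrow> 'k mat monoid" where
  "triangular_group _ n = \<lparr>
     carrier = {A \<in> carrier_mat n n. upper_triangular A \<and> invertible_mat A},
     mult = (*),
     one = 1\<^sub>m n\<rparr>"

lemma upper_triangular_times:
  fixes A B :: "'k :: field mat"
  assumes A: "A \<in> carrier_mat n n" "upper_triangular A"
    and B: "B \<in> carrier_mat n n" "upper_triangular B"
  shows "upper_triangular (A * B)"
proof
  fix i j assume ij: "j < i" "i < dim_row (A * B)"
  have "(A * B) $$ (i, j) = (\<Sum>k = 0..<n. A $$ (i, k) * B $$ (k, j))"
    using ij A B by (auto simp: scalar_prod_def)
  also have "\<dots> = 0"
  proof (intro sum.neutral ballI)
    fix k assume k: "k \<in> {0..<n}"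
    show "A $$ (i, k) * B $$ (k, j) = 0"
      using upper_triangularD[OF A(2), of k i] upper_triangularD[OF B(2), of j k] k ij A(1) B(1)
      by (cases "k < i") auto
  qed
  finally show "(A * B) $$ (i, j) = 0" .
qed

lemma upper_triangular_inverse:
  fixes A B :: "'k :: field mat"
  assumes A: "A \<in> carrier_mat n n" "upper_triangular A"
    and B: "B \<in> carrier_mat n n" and BA: "B * A = 1\<^sub>m n"
  shows "upper_triangular B"
proof -
  have "\<forall>i. j < i \<longrightarrow> i < n \<longrightarrow> B $$ (i, j) = 0" if "j < n" for j
    using that
  proof (induction j rule: less_induct)
    case (less j)
    have eq: "B $$ (i, j) * A $$ (j, j) = (if i = j then 1 else 0)" if i: "j \<le> i" "i < n" for i
    proof -
      have "(\<Sum>k = 0..<n. B $$ (i, k) * A $$ (k, j)) = (B * A) $$ (i, j)"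
        using i A B by (auto simp: scalar_prod_def)
      also have "\<dots> = (if i = j then 1 else 0)"
        using i less.prems by (simp add: BA)
      moreover have "(\<Sum>k = 0..<n. B $$ (i, k) * A $$ (k, j))
          = (\<Sum>k = 0..<n. if k = j then B $$ (i, j) * A $$ (j, j) else 0)"
      proof (intro sum.cong refl)
        fix k assume k: "k \<in> {0..<n}"
        show "B $$ (i, k) * A $$ (k, j) = (if k = j then B $$ (i, j) * A $$ (j, j) else 0)"
          using less.IH[of k] upper_triangularD[OF A(2), of j k] k i A(1)
          by (cases k j rule: linorder_cases) auto
      qed
      ultimately show ?thesis
        using less.prems by (simp add: sum.delta)
    qed
    have "A $$ (j, j) \<noteq> 0"
      using eq[of j] less.prems by auto
    then show ?case
      by (metis eq less_imp_le mult_eq_0_iff nat_neq_iff)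
  qed
  then show ?thesis
    using B by (intro upper_triangularI) auto
qed

lemma group_triangular_group: "group (triangular_group TYPE('k :: field) n)"
proof (rule groupI)
  fix A B assume "A \<in> carrier (triangular_group TYPE('k) n)"
    and "B \<in> carrier (triangular_group TYPE('k) n)"
  then have A: "A \<in> carrier_mat n n" "upper_triangular A" "invertible_mat A"
    and B: "B \<in> carrier_mat n n" "upper_triangular B" "invertible_mat B"
    by (auto simp: triangular_group_def)
  obtain A' where A': "A * A' = 1\<^sub>m n" "A' * A = 1\<^sub>m (dim_row A')"
    using A by (auto simp: invertible_mat_def inverts_mat_def)
  obtain B' where B': "B * B' = 1\<^sub>m n" "B' * B = 1\<^sub>m (dim_row B')"
    using B by (auto simp: invertible_mat_def inverts_mat_def)
  have dims: "A' \<in> carrier_mat n n" "B' \<in> carrier_mat n n"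
    using A' B' A(1) B(1) by (metis carrier_matD carrier_matI index_mult_mat(2,3) index_one_mat(2,3))+
  have "(A * B) * (B' * A') = A * ((B * B') * A')" "(B' * A') * (A * B) = B' * ((A' * A) * B)"
    using A(1) B(1) dims by (simp_all add: assoc_mult_mat[of _ n n _ n _ n])
  then have "(A * B) * (B' * A') = 1\<^sub>m n" "(B' * A') * (A * B) = 1\<^sub>m n"
    using A' B' A(1) B(1) dims by simp_all
  then have "invertible_mat (A * B)"
    using A(1) B(1) dims unfolding invertible_mat_def inverts_mat_def square_mat.simps
    by (intro conjI exI[of _ "B' * A'"]) auto
  then show "A \<otimes>\<^bsub>triangular_group TYPE('k) n\<^esub> B \<in> carrier (triangular_group TYPE('k) n)"
    using A B upper_triangular_times[OF A(1,2) B(1,2)] by (auto simp: triangular_group_def)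
next
  show "\<one>\<^bsub>triangular_group TYPE('k) n\<^esub> \<in> carrier (triangular_group TYPE('k) n)"
    by (auto simp: triangular_group_def invertible_mat_def inverts_mat_def
        intro!: exI[of _ "1\<^sub>m n"])
next
  fix A assume "A \<in> carrier (triangular_group TYPE('k) n)"
  then have A: "A \<in> carrier_mat n n" "upper_triangular A" "invertible_mat A"
    by (auto simp: triangular_group_def)
  obtain A' where A': "A * A' = 1\<^sub>m n" "A' * A = 1\<^sub>m (dim_row A')"
    using A by (auto simp: invertible_mat_def inverts_mat_def)
  have dims: "A' \<in> carrier_mat n n"
    using A' A(1) by (metis carrier_matD carrier_matI index_mult_mat(2,3) index_one_mat(2,3))
  have "upper_triangular A'"
    using upper_triangular_inverse[OF A(1,2) dims] A'(2) dims by simp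
  moreover have "invertible_mat A'"
    using A' A(1) dims unfolding invertible_mat_def inverts_mat_def square_mat.simps
    by (intro conjI exI[of _ A]) auto
  ultimately show "\<exists>B\<in>carrier (triangular_group TYPE('k) n).
      B \<otimes>\<^bsub>triangular_group TYPE('k) n\<^esub> A = \<one>\<^bsub>triangular_group TYPE('k) n\<^esub>"
    using A'(2) dims by (auto simp: triangular_group_def)
qed (auto simp: triangular_group_def assoc_mult_mat)

end

theory Submission
  imports Defs "Jordan_Normal_Form.Determinant"
begin

text \<open>Let \<open>UT n d\<close> consist of the triangular matrices \<open>1 + N\<close> with \<open>N\<close> supported on and above the
  \<open>d\<close>-th superdiagonal; thus \<open>UT n 0\<close> is the whole group and \<open>UT n 1\<close> the unitriangular group. By
  induction on the bracketing, the set of values of an outer commutator word is some \<open>UT n d\<close>, hence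
  a subgroup: the variables of the two sides of a bracket are disjoint, so it is enough that
  the commutators \<open>[x, y]\<close> with \<open>x \<in> UT n a\<close> and \<open>y \<in> UT n b\<close> fill up some \<open>UT n c\<close>.
  Now \<open>z = [x, y]\<close> means that \<open>y\<close> conjugates \<open>x\<close> to \<open>x z\<close>, and such \<open>y\<close> can be written down
  explicitly because every matrix with nothing below its \<open>a\<close>-th superdiagonal and no zero on it is
  conjugate to the shift by \<open>a\<close>.\<close>

section \<open>Commutators and word values in an arbitrary group\<close>

definition gcomm :: "('a, 'b) monoid_scheme \<Rightarrow> 'a \<Rightarrow> 'a \<Rightarrow> 'a" where
  "gcomm G x y = inv\<^bsub>G\<^esub> x \<otimes>\<^bsub>G\<^esub> inv\<^bsub>G\<^esub> y \<otimes>\<^bsub>G\<^esub> (x \<otimes>\<^bsub>G\<^esub> y)"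

context group
begin

lemma gcomm_alt:
  assumes "x \<in> carrier G" "y \<in> carrier G"
  shows "gcomm G x y = inv (y \<otimes> x) \<otimes> (x \<otimes> y)"
  using assms by (simp add: gcomm_def inv_mult_group)

lemma inv_gcomm:
  assumes "x \<in> carrier G" "y \<in> carrier G"
  shows "inv (gcomm G x y) = gcomm G y x"
  using assms by (simp add: gcomm_alt inv_mult_group)

text \<open>Reads the commutator equation as "\<open>y\<close> conjugates \<open>x\<close> to
  \<open>x z\<close>". No inverse occurs in the hypothesis, so for matrices it can be checked by
  plain multiplication.\<close>

lemma gcommI:
  assumes "x \<in> carrier G" "y \<in> carrier G" "z \<in> carrier G" "x \<otimes> y = y \<otimes> (x \<otimes> z)"
  shows "z = gcomm G x y"
proof -
  have "x \<otimes> y = (y \<otimes> x) \<otimes> z"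
    using assms by (simp add: m_assoc)
  then show ?thesis
    using assms(1-3) inv_solve_left[of z "y \<otimes> x" "x \<otimes> y"] by (simp add: gcomm_alt)
qed

lemma list_prod_closed: "set gs \<subseteq> carrier G \<Longrightarrow> list_prod G gs \<in> carrier G"
  by (induction gs) (auto simp: list_prod_def)

lemma list_prod_append:
  "\<lbrakk>set gs \<subseteq> carrier G; set hs \<subseteq> carrier G\<rbrakk>
    \<Longrightarrow> list_prod G (gs @ hs) = list_prod G gs \<otimes> list_prod G hs"
proof (induction gs)
  case Nil
  then show ?case
    using list_prod_closed[of hs] by (simp add: list_prod_def)
next
  case (Cons g gs)
  then show ?case
    using list_prod_closed[of gs] list_prod_closed[of hs] by (simp add: list_prod_def m_assoc)
qed

lemma word_letters_closed:
  "\<sigma> \<in> UNIV \<rightarrow> carrier G \<Longrightarrow>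
    set (map (\<lambda>(x, b). if b then \<sigma> x else inv (\<sigma> x)) w) \<subseteq> carrier G"
  by (auto simp: Pi_iff)

lemma word_value_closed: "\<sigma> \<in> UNIV \<rightarrow> carrier G \<Longrightarrow> word_value G \<sigma> w \<in> carrier G"
  unfolding word_value_def by (intro list_prod_closed word_letters_closed)

lemma word_value_append:
  "\<sigma> \<in> UNIV \<rightarrow> carrier G \<Longrightarrow>
    word_value G \<sigma> (u @ v) = word_value G \<sigma> u \<otimes> word_value G \<sigma> v"
  unfolding word_value_def map_append by (intro list_prod_append word_letters_closed)

lemma word_value_singleton:
  assumes "\<sigma> \<in> UNIV \<rightarrow> carrier G"
  shows "word_value G \<sigma> [(x, b)] = (if b then \<sigma> x else inv (\<sigma> x))"
proof -
  have "\<sigma> x \<in> carrier G"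
    using assms by auto
  then show ?thesis
    by (simp add: word_value_def list_prod_def)
qed

lemma word_value_inv:
  assumes \<sigma>: "\<sigma> \<in> UNIV \<rightarrow> carrier G"
  shows "word_value G \<sigma> (word_inv w) = inv (word_value G \<sigma> w)"
proof (induction w)
  case Nil
  then show ?case
    by (simp add: word_inv_def word_value_def list_prod_def)
next
  case (Cons l w)
  obtain x b where l: "l = (x, b)"
    by (cases l)
  have "\<sigma> x \<in> carrier G"
    using \<sigma> by auto
  have "word_value G \<sigma> (word_inv (l # w))
      = word_value G \<sigma> (word_inv w) \<otimes> word_value G \<sigma> [(x, \<not> b)]"
    by (simp add: word_inv_def l word_value_append[OF \<sigma>])
  also have "\<dots> = inv (word_value G \<sigma> w) \<otimes> inv (word_value G \<sigma> [l])"
    using Cons \<open>\<sigma> x \<in> carrier G\<close> by (simp add: l word_value_singleton[OF \<sigma>])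
  also have "\<dots> = inv (word_value G \<sigma> ([l] @ w))"
    by (simp only: word_value_append[OF \<sigma>] inv_mult_group word_value_closed[OF \<sigma>])
  finally show ?case
    by simp
qed

lemma word_value_comm:
  assumes \<sigma>: "\<sigma> \<in> UNIV \<rightarrow> carrier G"
  shows "word_value G \<sigma> (word_comm u v) = gcomm G (word_value G \<sigma> u) (word_value G \<sigma> v)"
  by (simp add: word_comm_def gcomm_def word_value_append[OF \<sigma>] word_value_inv[OF \<sigma>]
      word_value_closed[OF \<sigma>] m_assoc)

lemma word_values_variable: "word_values G [(x, True)] = carrier G"
proof
  show "word_values G [(x, True)] \<subseteq> carrier G"
    using word_value_closed by (auto simp: word_values_def)
  show "carrier G \<subseteq> word_values G [(x, True)]"
  proof
    fix g assume "g \<in> carrier G"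
    then have "(\<lambda>_. g) \<in> UNIV \<rightarrow> carrier G" "word_value G (\<lambda>_. g) [(x, True)] = g"
      by (auto simp: word_value_def list_prod_def)
    then show "g \<in> word_values G [(x, True)]"
      unfolding word_values_def by (intro CollectI exI[of _ "\<lambda>_. g"] conjI) simp_all
  qed
qed

end

section \<open>Values of a bracket of two words, and a criterion for width one\<close>

lemma word_value_cong:
  assumes "\<And>x. x \<in> fst ` set w \<Longrightarrow> \<sigma> x = \<tau> x"
  shows "word_value G \<sigma> w = word_value G \<tau> w"
proof -
  have "map (\<lambda>(x, b). if b then \<sigma> x else inv\<^bsub>G\<^esub> (\<sigma> x)) w
      = map (\<lambda>(x, b). if b then \<tau> x else inv\<^bsub>G\<^esub> (\<tau> x)) w"
    using assms by (intro map_cong refl) force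
  then show ?thesis
    by (simp only: word_value_def)
qed

lemma vars_word_inv: "fst ` set (word_inv w) = fst ` set w"
  by (force simp: word_inv_def image_iff)

lemma vars_commutator_bracketing: "commutator_bracketing xs w \<Longrightarrow> fst ` set w = set xs"
  by (induction rule: commutator_bracketing.induct)
    (simp_all add: word_comm_def image_Un vars_word_inv Un_ac)

text \<open>With no shared variable, the assignments for \<open>u\<close> and for \<open>v\<close>
  can be chosen independently and glued into a single one, so the two sides of the bracket take
  their values independently.\<close>

lemma (in group) word_values_comm:
  assumes "fst ` set u \<inter> fst ` set v = {}"
  shows "word_values G (word_comm u v)
    = {gcomm G x y | x y. x \<in> word_values G u \<and> y \<in> word_values G v}" (is "?L = ?R")
proof
  show "?L \<subseteq> ?R"
    unfolding word_values_def using word_value_comm by blast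
  show "?R \<subseteq> ?L"
  proof
    fix z assume "z \<in> ?R"
    then obtain \<sigma> \<tau> where \<sigma>: "\<sigma> \<in> UNIV \<rightarrow> carrier G" and \<tau>: "\<tau> \<in> UNIV \<rightarrow> carrier G"
      and z: "z = gcomm G (word_value G \<sigma> u) (word_value G \<tau> v)"
      by (auto simp: word_values_def)
    define \<rho> where "\<rho> x = (if x \<in> fst ` set u then \<sigma> x else \<tau> x)" for x
    have \<rho>: "\<rho> \<in> UNIV \<rightarrow> carrier G"
      using \<sigma> \<tau> by (simp add: \<rho>_def Pi_iff)
    have "word_value G \<rho> u = word_value G \<sigma> u"
      by (rule word_value_cong) (simp add: \<rho>_def)
    moreover have "word_value G \<rho> v = word_value G \<tau> v"
      using assms by (intro word_value_cong) (auto simp: \<rho>_def)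
    ultimately have "z = word_value G \<rho> (word_comm u v)"
      by (simp add: z word_value_comm[OF \<rho>])
    then show "z \<in> ?L"
      using \<rho> by (auto simp: word_values_def)
  qed
qed

text \<open>If the values already form a subgroup, generating adds nothing and each element is a
  product of one value. That the least bound is not 0 comes from the condition
  \<open>1 \<le> m\<close> in \<open>wid\<close>.\<close>

lemma (in group) wid_eq_1:
  assumes "subgroup (word_values G w) G"
  shows "wid G w = 1"
  unfolding wid_def
proof (rule Least_equality)
  have "verbal_subgroup G w = word_values G w"
    unfolding verbal_subgroup_def
    using generate_subgroup_incl[OF subset_refl assms] generate.incl by fast
  moreover have "\<exists>gs. enat (length gs) \<le> 1 \<and>
      set gs \<subseteq> word_values G w \<union> m_inv G ` word_values G w \<and> g = list_prod G gs"
    if g: "g \<in> word_values G w" for g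
    using g subgroup.mem_carrier[OF assms g]
    by (intro exI[of _ "[g]"]) (auto simp: list_prod_def one_enat_def)
  ultimately show "1 \<le> (1 :: enat) \<and> (\<forall>g \<in> verbal_subgroup G w. \<exists>gs. enat (length gs) \<le> 1 \<and>
      set gs \<subseteq> word_values G w \<union> m_inv G ` word_values G w \<and> g = list_prod G gs)"
    by simp
qed simp

section \<open>Matrices supported on and above a superdiagonal\<close>

text \<open>Level 0 consists of the upper triangular matrices, and any level
  \<open>d \<ge> n\<close> contains only the zero matrix. Levels add under multiplication, see
  \<open>band_mult\<close>.\<close>

definition band :: "nat \<Rightarrow> nat \<Rightarrow> 'k :: field mat set" where
  "band n d = {A \<in> carrier_mat n n. \<forall>i<n. \<forall>j<n. j < i + d \<longrightarrow> A $$ (i, j) = 0}"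

lemma bandI:
  "A \<in> carrier_mat n n \<Longrightarrow> (\<And>i j. \<lbrakk>i < n; j < n; j < i + d\<rbrakk> \<Longrightarrow> A $$ (i, j) = 0) \<Longrightarrow> A \<in> band n d"
  by (auto simp: band_def)

lemma band_carrier: "A \<in> band n d \<Longrightarrow> A \<in> carrier_mat n n"
  by (simp add: band_def)

lemma band_zero: "\<lbrakk>A \<in> band n d; i < n; j < n; j < i + d\<rbrakk> \<Longrightarrow> A $$ (i, j) = 0"
  by (simp add: band_def)

lemma band_mono: "d \<le> e \<Longrightarrow> band n e \<subseteq> band n d"
  by (auto simp: band_def)

lemma band_add: "\<lbrakk>A \<in> band n d; B \<in> band n d\<rbrakk> \<Longrightarrow> A + B \<in> band n d"
  by (auto simp: band_def)

lemma band_minus: "\<lbrakk>A \<in> band n d; B \<in> band n d\<rbrakk> \<Longrightarrow> A - B \<in> band n d"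
  by (auto simp: band_def)

lemma band_one: "1\<^sub>m n \<in> band n 0"
  by (auto simp: band_def)

lemma mat_mult_entry:
  "\<lbrakk>A \<in> carrier_mat n n; B \<in> carrier_mat n n; i < n; j < n\<rbrakk>
    \<Longrightarrow> (A * B) $$ (i, j) = (\<Sum>k<n. A $$ (i, k) * B $$ (k, j))"
  by (auto simp: scalar_prod_def lessThan_atLeast0)

lemma band_mult:
  assumes A: "A \<in> band n a" and B: "B \<in> band n b"
  shows "A * B \<in> band n (a + b)"
proof (rule bandI)
  show "A * B \<in> carrier_mat n n"
    using A B by (auto simp: band_def)
  fix i j assume ij: "i < n" "j < n" "j < i + (a + b)"
  have "(A * B) $$ (i, j) = (\<Sum>k<n. A $$ (i, k) * B $$ (k, j))"
    using ij A B band_carrier by (blast intro: mat_mult_entry)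
  also have "\<dots> = 0"
  proof (intro sum.neutral ballI)
    fix k assume "k \<in> {..<n}"
    then show "A $$ (i, k) * B $$ (k, j) = 0"
      using band_zero[OF A, of i k] band_zero[OF B, of k j] ij by (cases "k < i + a") auto
  qed
  finally show "(A * B) $$ (i, j) = 0" .
qed

section \<open>The triangular group and its diagonal entries\<close>

abbreviation TG :: "nat \<Rightarrow> 'k :: field mat monoid" where
  "TG n \<equiv> triangular_group TYPE('k) n"

lemma TG_simps [simp]: "\<one>\<^bsub>TG n\<^esub> = 1\<^sub>m n" "A \<otimes>\<^bsub>TG n\<^esub> B = A * B"
  by (simp_all add: triangular_group_def)

lemma TG_carrier: "A \<in> carrier (TG n) \<Longrightarrow> A \<in> carrier_mat n n"
  by (simp add: triangular_group_def)

lemma TG_band: "A \<in> carrier (TG n) \<Longrightarrow> A \<in> band n 0"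
  by (auto simp: triangular_group_def band_def)

text \<open>The determinant of a triangular matrix is the product of its diagonal entries, hence
  nonzero here, and this yields a two-sided inverse.\<close>

lemma TG_I:
  assumes A: "A \<in> band n 0" and diag: "\<And>i. i < n \<Longrightarrow> A $$ (i, i) \<noteq> 0"
  shows "A \<in> carrier (TG n)"
proof -
  have c: "A \<in> carrier_mat n n"
    using A by (rule band_carrier)
  then have ut: "upper_triangular A"
    using A by (intro upper_triangularI) (auto simp: band_def)
  have "det A = prod_list (diag_mat A)"
    using det_upper_triangular[OF ut c] .
  moreover have "0 \<notin> set (diag_mat A)"
    using diag c by (auto simp: diag_mat_def)
  ultimately have "det A \<noteq> 0"
    by (simp add: prod_list_zero_iff)
  from det_non_zero_imp_unit[OF c this, of "()"]
  obtain B where "B \<in> carrier_mat n n" "A * B = 1\<^sub>m n" "B * A = 1\<^sub>m n"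
    by (auto simp: Units_def ring_mat_def)
  then have "invertible_mat A"
    using c unfolding invertible_mat_def inverts_mat_def by auto
  with c ut show ?thesis
    by (simp add: triangular_group_def)
qed

lemma band_mult_diag:
  assumes A: "A \<in> band n 0" and B: "B \<in> band n 0" and i: "i < n"
  shows "(A * B) $$ (i, i) = A $$ (i, i) * B $$ (i, i)"
proof -
  have "(A * B) $$ (i, i) = (\<Sum>k<n. A $$ (i, k) * B $$ (k, i))"
    using i A B band_carrier by (blast intro: mat_mult_entry)
  also have "\<dots> = (\<Sum>k<n. if k = i then A $$ (i, i) * B $$ (i, i) else 0)"
  proof (intro sum.cong refl)
    fix k assume "k \<in> {..<n}"
    then show "A $$ (i, k) * B $$ (k, i) = (if k = i then A $$ (i, i) * B $$ (i, i) else 0)"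
      using band_zero[OF A, of i k] band_zero[OF B, of k i] i
      by (cases k i rule: linorder_cases) auto
  qed
  finally show ?thesis
    using i by simp
qed

text \<open>The inverse is triangular as well, and diagonals of triangular matrices multiply
  entrywise.\<close>

lemma TG_diag_nonzero:
  assumes "A \<in> carrier (TG n)" "i < n"
  shows "A $$ (i, i) \<noteq> 0"
proof -
  interpret group "TG n :: 'a mat monoid"
    by (rule group_triangular_group)
  have "A * inv\<^bsub>TG n\<^esub> A = 1\<^sub>m n"
    using r_inv[OF assms(1)] by simp
  then have "A $$ (i, i) * (inv\<^bsub>TG n\<^esub> A) $$ (i, i) = 1"
    using band_mult_diag[OF TG_band TG_band, of A n "inv\<^bsub>TG n\<^esub> A" i] assms by simp
  then show ?thesis
    by auto
qed

section \<open>The filtration of the triangular group by the subgroups \<open>UT n d\<close>\<close>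

definition UT :: "nat \<Rightarrow> nat \<Rightarrow> 'k :: field mat set" where
  "UT n d = {A \<in> carrier (TG n). A - 1\<^sub>m n \<in> band n d}"

lemma UT_TG: "A \<in> UT n d \<Longrightarrow> A \<in> carrier (TG n)"
  by (simp add: UT_def)

lemma UT_0: "UT n 0 = carrier (TG n)"
  using TG_band band_one by (auto simp: UT_def intro: band_minus)

lemma UT_mono: "d \<le> e \<Longrightarrow> UT n e \<subseteq> UT n d"
  using band_mono by (auto simp: UT_def)

lemma UT_1_I:
  assumes A: "A \<in> band n 0" and "\<And>i. i < n \<Longrightarrow> A $$ (i, i) = 1"
  shows "A \<in> UT n 1"
  using assms TG_I[OF A]
  by (auto simp: UT_def intro!: bandI elim: band_zero)
    (auto simp: band_def)

lemma one_plus_band_UT: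
  assumes N: "N \<in> band n d" and d: "1 \<le> d"
  shows "1\<^sub>m n + N \<in> UT n d"
proof -
  have c: "N \<in> carrier_mat n n"
    using N by (rule band_carrier)
  have "N $$ (i, i) = 0" if "i < n" for i
    using band_zero[OF N that that] d by simp
  moreover have "1\<^sub>m n + N \<in> band n 0"
    using N band_mono[of 0 d n] band_one by (auto intro: band_add)
  ultimately have "1\<^sub>m n + N \<in> carrier (TG n)"
    using c by (intro TG_I) auto
  moreover have "1\<^sub>m n + N - 1\<^sub>m n = N"
    using c by (intro eq_matI) auto
  ultimately show ?thesis
    using N by (simp add: UT_def)
qed

text \<open>Writing \<open>B'\<close> for the inverse of \<open>B\<close>, one has
  \<open>B' * A - 1 = B' * (A - B)\<close>, and a triangular factor keeps the band level.\<close>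

lemma UT_congruent:
  assumes A: "A \<in> carrier (TG n)" and B: "B \<in> carrier (TG n)" and AB: "A - B \<in> band n d"
  shows "inv\<^bsub>TG n\<^esub> B \<otimes>\<^bsub>TG n\<^esub> A \<in> UT n d"
proof -
  interpret group "TG n :: 'a mat monoid"
    by (rule group_triangular_group)
  define B' where "B' = inv\<^bsub>TG n\<^esub> B"
  have B': "B' \<in> carrier (TG n)"
    using B by (simp add: B'_def)
  have "B' * B = 1\<^sub>m n"
    using l_inv[OF B] by (simp add: B'_def)
  then have "B' * A - 1\<^sub>m n = B' * (A - B)"
    using A B B' TG_carrier by (metis mult_minus_distrib_mat)
  also have "\<dots> \<in> band n (0 + d)"
    using TG_band[OF B'] AB by (rule band_mult)
  finally have "B' * A - 1\<^sub>m n \<in> band n d"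
    by simp
  moreover have "B' * A \<in> carrier (TG n)"
    using m_closed[OF B' A] by simp
  ultimately show ?thesis
    by (simp add: UT_def B'_def)
qed

text \<open>Inverses come from \<open>UT_congruent\<close> with the identity in the role of its
  first matrix, products from \<open>A * B - 1 = A * (B - 1) + (A - 1)\<close>.\<close>

lemma UT_subgroup: "subgroup (UT n d) (TG n :: 'k :: field mat monoid)"
proof -
  interpret group "TG n :: 'k mat monoid"
    by (rule group_triangular_group)
  have inv: "inv\<^bsub>TG n\<^esub> A \<in> UT n d" if A: "A \<in> UT n d" for A :: "'k mat"
  proof -
    have c: "A \<in> carrier_mat n n"
      using A UT_TG TG_carrier by blast
    have "1\<^sub>m n - A = 0\<^sub>m n n - (A - 1\<^sub>m n)"
      using c by (intro eq_matI) auto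
    moreover have "0\<^sub>m n n \<in> band n d"
      by (auto simp: band_def)
    ultimately have "1\<^sub>m n - A \<in> band n d"
      using A band_minus unfolding UT_def by (metis (mono_tags, lifting) mem_Collect_eq)
    then show ?thesis
      using UT_congruent[of "1\<^sub>m n" n A d] UT_TG[OF A] one_closed r_one by fastforce
  qed
  show ?thesis
  proof
    show "UT n d \<subseteq> carrier (TG n :: 'k mat monoid)"
      by (auto simp: UT_def)
    show "\<one>\<^bsub>TG n\<^esub> \<in> (UT n d :: 'k mat set)"
      using one_closed by (auto simp: UT_def band_def)
    fix A B :: "'k mat" assume A: "A \<in> UT n d" and B: "B \<in> UT n d"
    have "A - \<one>\<^bsub>TG n\<^esub> \<in> band n d" "inv\<^bsub>TG n\<^esub> B - \<one>\<^bsub>TG n\<^esub> \<in> band n d"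
      using A inv[OF B] by (auto simp: UT_def)
    have c: "A \<in> carrier_mat n n" "B \<in> carrier_mat n n"
      using A B UT_TG TG_carrier by blast+
    have "A * B - 1\<^sub>m n = A * (B - 1\<^sub>m n) + (A - 1\<^sub>m n)"
      using c by (subst mult_minus_distrib_mat[of _ n n]) (auto intro!: eq_matI)
    moreover have "A * (B - 1\<^sub>m n) \<in> band n (0 + d)"
      using A B by (intro band_mult TG_band) (auto simp: UT_def)
    ultimately have "A * B - 1\<^sub>m n \<in> band n d"
      using A by (simp add: UT_def band_add)
    then show "A \<otimes>\<^bsub>TG n\<^esub> B \<in> UT n d"
      using m_closed[OF UT_TG[OF A] UT_TG[OF B]] by (simp add: UT_def)
  qed (rule inv)
qed

text \<open>The commutator is the inverse of \<open>y * x\<close> times \<open>x * y\<close>, so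
  \<open>UT_congruent\<close> reduces both claims to the band level of \<open>x * y - y * x\<close>.
  With \<open>x = 1 + N\<close> and \<open>y = 1 + M\<close> this difference is
  \<open>N * M - M * N\<close>, of level \<open>a + b\<close>; its diagonal always vanishes, which
  gives level 1 even for \<open>a = b = 0\<close>.\<close>

lemma UT_comm_subset:
  fixes x y :: "'k :: field mat"
  assumes x: "x \<in> UT n a" and y: "y \<in> UT n b"
  shows "gcomm (TG n) x y \<in> UT n (a + b)" "gcomm (TG n) x y \<in> UT n 1"
proof -
  interpret group "TG n :: 'k mat monoid"
    by (rule group_triangular_group)
  have X: "x \<in> carrier (TG n)" and Y: "y \<in> carrier (TG n)"
    using x y UT_TG by blast+
  have c: "x \<in> carrier_mat n n" "y \<in> carrier_mat n n"
    using X Y TG_carrier by blast+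
  have g: "gcomm (TG n) x y = inv\<^bsub>TG n\<^esub> (y \<otimes>\<^bsub>TG n\<^esub> x) \<otimes>\<^bsub>TG n\<^esub> (x \<otimes>\<^bsub>TG n\<^esub> y)"
    using X Y by (rule gcomm_alt)
  define N M where "N = x - 1\<^sub>m n" and "M = y - 1\<^sub>m n"
  have NM: "N \<in> band n a" "M \<in> band n b"
    using x y by (auto simp: UT_def N_def M_def)
  have "N * M - M * N = x * y - y * x"
  proof -
    have cNM: "N \<in> carrier_mat n n" "M \<in> carrier_mat n n"
      using NM band_carrier by blast+
    have "x = N + 1\<^sub>m n" "y = M + 1\<^sub>m n"
      using c by (auto simp: N_def M_def intro!: eq_matI)
    then have "x * y = N * M + M + N + 1\<^sub>m n" "y * x = M * N + N + M + 1\<^sub>m n"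
      using cNM by (auto simp: add_mult_distrib_mat[of _ n n] mult_add_distrib_mat[of _ n n]
        intro!: eq_matI)
    then show ?thesis
      using cNM by (auto intro!: eq_matI)
  qed
  moreover have "N * M - M * N \<in> band n (a + b)"
    using band_mult[OF NM] band_mult[OF NM(2,1)] by (simp add: band_minus add.commute)
  ultimately show "gcomm (TG n) x y \<in> UT n (a + b)"
    unfolding g using m_closed X Y by (intro UT_congruent) auto
  have "x * y - y * x \<in> band n 1"
  proof (rule bandI)
    have b0: "x * y \<in> band n 0" "y * x \<in> band n 0"
      using band_mult[OF TG_band[OF X] TG_band[OF Y]] band_mult[OF TG_band[OF Y] TG_band[OF X]]
      by simp_all
    fix i j assume ij: "i < n" "j < n" "j < i + 1"
    show "(x * y - y * x) $$ (i, j) = 0"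
    proof (cases "j = i")
      case True
      then show ?thesis
        using ij c band_mult_diag[OF TG_band[OF X] TG_band[OF Y], of i]
          band_mult_diag[OF TG_band[OF Y] TG_band[OF X], of i] by simp
    next
      case False
      then show ?thesis
        using ij c band_zero[OF b0(1), of i j] band_zero[OF b0(2), of i j] by simp
    qed
  qed (use c in auto)
  then show "gcomm (TG n) x y \<in> UT n 1"
    unfolding g using m_closed X Y by (intro UT_congruent) auto
qed

section \<open>Conjugating matrices to a shift\<close>

definition shift :: "nat \<Rightarrow> nat \<Rightarrow> 'k :: field mat" where
  "shift n a = mat n n (\<lambda>(i, j). if j = i + a then 1 else 0)"

lemma shift_carrier: "shift n a \<in> carrier_mat n n"
  by (simp add: shift_def)

lemma shift_band: "shift n a \<in> band n a"
  by (auto simp: shift_def band_def)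

lemma shift_mult_entry:
  assumes X: "X \<in> carrier_mat n n" and ij: "i < n" "j < n"
  shows "(shift n a * X) $$ (i, j) = (if i + a < n then X $$ (i + a, j) else 0)"
proof -
  have "(shift n a * X) $$ (i, j) = (\<Sum>k<n. shift n a $$ (i, k) * X $$ (k, j))"
    using mat_mult_entry[OF shift_carrier X ij] .
  also have "\<dots> = (\<Sum>k<n. if k = i + a then X $$ (i + a, j) else 0)"
    using ij by (intro sum.cong) (auto simp: shift_def)
  finally show ?thesis
    by (simp add: sum.delta)
qed

text \<open>The equation \<open>shift n a * X = X * Q\<close> says that row \<open>i + a\<close> of \<open>X\<close> is row \<open>i\<close> multiplied by \<open>Q\<close>,
  so the first \<open>a\<close> rows can be prescribed freely (as unit vectors) and determine the others.\<close>

lemma shift_intertwiner: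
  fixes Q :: "'k :: field mat"
  assumes a: "1 \<le> a" and b: "1 \<le> b" and Q: "Q \<in> carrier_mat n n"
    and off: "\<And>i j. \<lbrakk>i < n; j < n; j < i + a + b; j \<noteq> i + a\<rbrakk> \<Longrightarrow> Q $$ (i, j) = 0"
    and nz: "\<And>i. i + a < n \<Longrightarrow> Q $$ (i, i + a) \<noteq> 0"
  obtains X where "X \<in> carrier (TG n)" "shift n a * X = X * Q"
    "(\<And>i. i + a < n \<Longrightarrow> Q $$ (i, i + a) = 1) \<Longrightarrow> X \<in> UT n b"
proof -
  \<comment> \<open>Solves the recursion for the rows: row \<open>i\<close> is the unit row vector
    with index \<open>i mod a\<close>, multiplied \<open>i div a\<close> times by
    \<open>Q\<close>.\<close>
  define X where "X = mat n n (\<lambda>(i, j). (Q ^\<^sub>m (i div a)) $$ (i mod a, j))"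
  have X: "X \<in> carrier_mat n n"
    by (simp add: X_def)
  have XQ: "(X * Q) $$ (i, j) = (\<Sum>k<n. X $$ (i, k) * Q $$ (k, j))" if "i < n" "j < n" for i j
    using mat_mult_entry[OF X Q that] .
  have base: "X $$ (i, j) = (if i = j then 1 else 0)" if "i < a" "i < n" "j < n" for i j
    using that Q by (simp add: X_def)
  have step: "X $$ (i + a, j) = (X * Q) $$ (i, j)" if "i + a < n" "j < n" for i j
  proof -
    have "i mod a < n"
      using that mod_less_eq_dividend[of i a] by linarith
    moreover have "Q ^\<^sub>m (i div a) \<in> carrier_mat n n"
      using Q by simp
    ultimately have "X $$ (i + a, j) = (\<Sum>k<n. (Q ^\<^sub>m (i div a)) $$ (i mod a, k) * Q $$ (k, j))"
      using that a Q mat_mult_entry[of "Q ^\<^sub>m (i div a)" n Q "i mod a" j] by (simp add: X_def)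
    also have "\<dots> = (X * Q) $$ (i, j)"
      using that XQ by (simp add: X_def)
    finally show ?thesis .
  qed
  \<comment> \<open>Only \<open>k = i\<close> survives in the sum: smaller \<open>k\<close> and
    those strictly between \<open>i\<close> and \<open>i + b\<close> are excluded by
    \<open>row\<close>, while \<open>k \<ge> i + b\<close> gives \<open>j < k + a\<close>, where
    \<open>Q\<close> vanishes by \<open>off\<close>.\<close>
  have entry: "(X * Q) $$ (i, j) = X $$ (i, i) * Q $$ (i, j)"
    if ij: "i < n" "j < n" "j < i + a + b"
      and row: "\<And>k. \<lbrakk>k < n; k < i + b; k \<noteq> i\<rbrakk> \<Longrightarrow> X $$ (i, k) = 0" for i j
  proof -
    have "(X * Q) $$ (i, j) = (\<Sum>k<n. if k = i then X $$ (i, i) * Q $$ (i, j) else 0)"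
      unfolding XQ[OF ij(1,2)]
    proof (intro sum.cong refl)
      fix k assume "k \<in> {..<n}"
      then show "X $$ (i, k) * Q $$ (k, j) = (if k = i then X $$ (i, i) * Q $$ (i, j) else 0)"
        using row[of k] off[of k j] ij b by (cases "k < i + b") auto
    qed
    then show ?thesis
      using ij by simp
  qed
  \<comment> \<open>The gap of width \<open>b\<close> that \<open>Q\<close> has after its
    \<open>a\<close>-th superdiagonal is inherited by \<open>X\<close> after its main diagonal,
    through induction from row \<open>i'\<close> to row \<open>i' + a\<close>.\<close>
  have Xrow: "X $$ (i, j) = 0" if "i < n" "j < n" "j < i + b" "j \<noteq> i" for i j
    using that
  proof (induction i arbitrary: j rule: less_induct)
    case (less i)
    show ?case
    proof (cases "i < a")
      case True
      then show ?thesis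
        using less.prems base by simp
    next
      case False
      then obtain i' where i: "i = i' + a"
        by (metis add.commute le_Suc_ex not_less)
      have "X $$ (i, j) = X $$ (i', i') * Q $$ (i', j)"
        using less.prems a less.IH[of i'] by (simp add: i step entry)
      then show ?thesis
        using less.prems off[of i' j] by (simp add: i)
    qed
  qed
  have Xdiag: "X $$ (i + a, i + a) = X $$ (i, i) * Q $$ (i, i + a)" if "i + a < n" for i
    using that b Xrow by (simp add: step entry)
  have induct_a: "P i" if "\<And>i. i < a \<Longrightarrow> P i" "\<And>i. P i \<Longrightarrow> P (i + a)" for P and i :: nat
  proof (induction i rule: less_induct)
    case (less i)
    show ?case
    proof (cases "i < a")
      case False
      then have "i = (i - a) + a" "i - a < i"
        using a by auto
      then show ?thesis
        using less that(2)[of "i - a"] by simp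
    qed (rule that(1))
  qed
  have "i < n \<longrightarrow> X $$ (i, i) \<noteq> 0" for i
    by (rule induct_a[of _ i]) (use base Xdiag nz in auto)
  moreover have "X \<in> band n 0"
    using X Xrow by (intro bandI) auto
  ultimately have "X \<in> carrier (TG n)"
    by (intro TG_I) auto
  moreover have "shift n a * X = X * Q"
  proof (rule eq_matI)
    fix i j assume "i < dim_row (X * Q)" "j < dim_col (X * Q)"
    then have ij: "i < n" "j < n"
      using X Q by auto
    show "(shift n a * X) $$ (i, j) = (X * Q) $$ (i, j)"
    proof (cases "i + a < n")
      case True
      then show ?thesis
        using ij step by (simp add: shift_mult_entry[OF X])
    next
      \<comment> \<open>There is no row \<open>i + a\<close>, so the left side is 0. On the right
        \<open>entry\<close> leaves a multiple of \<open>Q $$ (i, j)\<close>, which is 0 because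
        \<open>j < n \<le> i + a\<close>.\<close>
      case False
      have "(X * Q) $$ (i, j) = X $$ (i, i) * Q $$ (i, j)"
        using ij False Xrow by (intro entry) auto
      then show ?thesis
        using False ij off[of i j] by (simp add: shift_mult_entry[OF X])
    qed
  qed (use X Q shift_carrier[of n a] in auto)
  moreover have "X \<in> UT n b" if one: "\<And>i. i + a < n \<Longrightarrow> Q $$ (i, i + a) = 1"
  proof -
    have "i < n \<longrightarrow> X $$ (i, i) = 1" for i
      by (rule induct_a[of _ i]) (use base Xdiag one in auto)
    then have "X - 1\<^sub>m n \<in> band n b"
      using X Xrow by (intro bandI) auto
    with \<open>X \<in> carrier (TG n)\<close> show ?thesis
      by (simp add: UT_def)
  qed
  ultimately show ?thesis
    using that by blast
qed

lemma one_plus_shift_UT: "1 \<le> a \<Longrightarrow> 1\<^sub>m n + shift n a \<in> UT n a"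
  by (intro one_plus_band_UT shift_band)

text \<open>Adding the identity turns an intertwining relation between nilpotent parts into
  conjugacy of group elements.\<close>

lemma one_plus_shift_mult:
  assumes X: "X \<in> carrier_mat n n" and Z: "Z \<in> carrier_mat n n"
    and eq: "shift n a * X = X * (Z - 1\<^sub>m n)"
  shows "(1\<^sub>m n + shift n a) * X = X * Z"
proof -
  have "(1\<^sub>m n + shift n a) * X = X + X * (Z - 1\<^sub>m n)"
    using X by (simp add: add_mult_distrib_mat[OF one_carrier_mat shift_carrier X] eq)
  also have "X * (Z - 1\<^sub>m n) = X * Z - X"
    using X Z by (simp add: mult_minus_distrib_mat[of _ n n])
  also have "X + (X * Z - X) = X * Z"
    using X Z by (intro eq_matI) auto
  finally show ?thesis .
qed

section \<open>Realizing the elements of a level as commutators\<close>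

text \<open>A single \<open>x = 1 + shift n a\<close> serves all \<open>z\<close>. Since
  \<open>x * z - x\<close> has level \<open>a + b\<close>, the matrix \<open>x * z - 1\<close>
  agrees with the shift below the superdiagonal \<open>a + b\<close>; its entries on the
  superdiagonal \<open>a\<close> are 1, so the intertwiner \<open>y\<close> conjugating
  \<open>x\<close> to \<open>x * z\<close> lies in \<open>UT n b\<close>.\<close>

lemma UT_comm_surj:
  fixes z :: "'k :: field mat"
  assumes a: "1 \<le> a" and b: "1 \<le> b" and z: "z \<in> UT n (a + b)"
  obtains x y where "x \<in> UT n a" "y \<in> UT n b" "z = gcomm (TG n) x y"
proof -
  interpret group "TG n :: 'k mat monoid"
    by (rule group_triangular_group)
  define x :: "'k mat" where "x = 1\<^sub>m n + shift n a"
  have x: "x \<in> UT n a"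
    unfolding x_def using a by (rule one_plus_shift_UT)
  define M where "M = x * (z - 1\<^sub>m n)"
  define Q where "Q = x * z - 1\<^sub>m n"
  have X: "x \<in> carrier (TG n)" and Z: "z \<in> carrier (TG n)"
    using x z UT_TG by blast+
  then have c: "x \<in> carrier_mat n n" "z \<in> carrier_mat n n"
    using TG_carrier by blast+
  have "M \<in> band n (0 + (a + b))"
    unfolding M_def using TG_band[OF X] z by (intro band_mult) (auto simp: UT_def)
  then have M: "M \<in> band n (a + b)"
    by simp
  have "M = x * z - x"
    unfolding M_def using c by (simp add: mult_minus_distrib_mat[of _ n n])
  moreover have "x * z - 1\<^sub>m n = shift n a + (x * z - x)"
  proof -
    have "W - 1\<^sub>m n = shift n a + (W - x)" if "W \<in> carrier_mat n n" for W
      using that by (intro eq_matI) (auto simp: x_def shift_def)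
    then show ?thesis
      using c by simp
  qed
  ultimately have QM: "Q = shift n a + M"
    by (simp add: Q_def)
  have Q: "Q $$ (i, j) = (if j = i + a then 1 else 0)" if "i < n" "j < n" "j < i + a + b" for i j
    using that band_zero[OF M, of i j] band_carrier[OF M] by (simp add: QM shift_def)
  have Qc: "Q \<in> carrier_mat n n"
    using c by (auto simp: Q_def)
  have off: "Q $$ (i, j) = 0" if "i < n" "j < n" "j < i + a + b" "j \<noteq> i + a" for i j
    using that Q by simp
  have one: "Q $$ (i, i + a) = 1" if "i + a < n" for i
    using that Q b by simp
  then have "Q $$ (i, i + a) \<noteq> 0" if "i + a < n" for i
    using that by simp
  with one obtain y where y: "shift n a * y = y * Q" "y \<in> UT n b"
    using shift_intertwiner[OF a b Qc off] by blast
  have Y: "y \<in> carrier (TG n)"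
    using y(2) by (rule UT_TG)
  have "x * y = y * (x * z)"
    unfolding x_def
    by (rule one_plus_shift_mult) (use c Y TG_carrier y in \<open>auto simp: Q_def x_def\<close>)
  then have "z = gcomm (TG n) x y"
    using X Y Z by (intro gcommI) auto
  with that x y(2) show ?thesis
    by blast
qed

text \<open>This is \<open>shift_intertwiner\<close> with gap 1, where \<open>off\<close> reduces to
  the band condition on \<open>y - 1\<close>. The superdiagonal entries need not be 1, so the
  conjugator is only known to be triangular.\<close>

lemma full_superdiagonal_conj:
  fixes y :: "'k :: field mat"
  assumes b: "1 \<le> b" and y: "y \<in> UT n b" and nz: "\<And>i. i + b < n \<Longrightarrow> y $$ (i, i + b) \<noteq> 0"
  obtains x where "x \<in> carrier (TG n)" "(1\<^sub>m n + shift n b) * x = x * y"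
proof -
  have Y: "y \<in> carrier_mat n n" and Q: "y - 1\<^sub>m n \<in> band n b"
    using y TG_carrier by (auto simp: UT_def)
  have off: "(y - 1\<^sub>m n) $$ (i, j) = 0" if "i < n" "j < n" "j < i + b + 1" "j \<noteq> i + b" for i j
    using band_zero[OF Q that(1,2)] that by simp
  have nz': "(y - 1\<^sub>m n) $$ (i, i + b) \<noteq> 0" if "i + b < n" for i
    using nz[OF that] that b Y by simp
  obtain x where x: "x \<in> carrier (TG n)" "shift n b * x = x * (y - 1\<^sub>m n)"
    using shift_intertwiner[OF b order_refl band_carrier[OF Q] off nz'] by blast
  then show ?thesis
    using that one_plus_shift_mult[OF _ Y] TG_carrier by blast
qed

text \<open>The idea is to multiply \<open>z\<close> by some \<open>y\<close> such that both \<open>y\<close> and \<open>z * y\<close> have no zero on the \<open>b\<close>-th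
  superdiagonal; this needs a third field element. Both are then conjugate to \<open>1\<^sub>m n + shift n b\<close>,
  and a relation \<open>z * y = inv g * y * g\<close> makes \<open>z\<close> a commutator.\<close>

lemma UT_comm_TG_surj:
  fixes z :: "'k :: field mat" and \<mu> :: 'k
  assumes \<mu>: "\<mu> \<noteq> 0" "\<mu> \<noteq> 1" and b: "1 \<le> b" and z: "z \<in> UT n b"
  obtains x y where "x \<in> carrier (TG n)" "y \<in> UT n b" "z = gcomm (TG n) x y"
proof -
  interpret group "TG n :: 'k mat monoid"
    by (rule group_triangular_group)
  \<comment> \<open>Superdiagonal entries of the auxiliary \<open>y\<close>. Adding
    \<open>p i\<close> to the entry \<open>t\<close> of \<open>z\<close> gives \<open>1\<close> if
    \<open>t = 0\<close> and \<open>(1 - \<mu>) * t\<close> otherwise, so neither \<open>p i\<close>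
    nor the sum vanishes.\<close>
  define p where "p i = (if z $$ (i, i + b) = 0 then 1 else - \<mu> * z $$ (i, i + b))" for i
  have p: "p i \<noteq> 0" "z $$ (i, i + b) + p i \<noteq> 0" for i
  proof -
    show "p i \<noteq> 0"
      using \<mu> by (simp add: p_def)
    have "z $$ (i, i + b) + p i = (1 - \<mu>) * z $$ (i, i + b)" if "z $$ (i, i + b) \<noteq> 0"
      using that by (simp add: p_def algebra_simps)
    then show "z $$ (i, i + b) + p i \<noteq> 0"
      using \<mu> by (cases "z $$ (i, i + b) = 0") (auto simp: p_def)
  qed
  define P where "P = mat n n (\<lambda>(i, j). if j = i + b then p i else 0)"
  have Pband: "P \<in> band n b"
    by (auto simp: P_def band_def)
  have Pc: "P \<in> carrier_mat n n"
    by (simp add: P_def)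
  define y where "y = 1\<^sub>m n + P"
  have y: "y \<in> UT n b"
    unfolding y_def using Pband b by (rule one_plus_band_UT)
  have Y: "y \<in> carrier (TG n)" and Z: "z \<in> carrier (TG n)"
    using y z UT_TG by blast+
  then have c: "y \<in> carrier_mat n n" "z \<in> carrier_mat n n"
    using TG_carrier by blast+
  have zy: "z * y \<in> UT n b"
    using subgroup.m_closed[OF UT_subgroup z y] by simp
  have y_nz: "y $$ (i, i + b) \<noteq> 0" if "i + b < n" for i
    using that p b by (simp add: y_def P_def)
  \<comment> \<open>On the \<open>b\<close>-th superdiagonal the entries of \<open>z\<close> and
    \<open>y\<close> simply add, because the product \<open>N * P\<close> of the nilpotent parts has
    level \<open>b + b > b\<close>.\<close>
  have zy_nz: "(z * y) $$ (i, i + b) \<noteq> 0" if i: "i + b < n" for i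
  proof -
    define N where "N = z - 1\<^sub>m n"
    have N: "N \<in> band n b" "N \<in> carrier_mat n n"
      using z band_carrier by (auto simp: N_def UT_def)
    have "z = 1\<^sub>m n + N"
      using c by (auto simp: N_def intro!: eq_matI)
    then have "z * y = y + N * y"
      using add_mult_distrib_mat[OF one_carrier_mat N(2) c(1)] c by simp
    also have "N * y = N + N * P"
      unfolding y_def using mult_add_distrib_mat[OF N(2) one_carrier_mat Pc] N by simp
    finally have "z * y = y + (N + N * P)" .
    moreover have "(N * P) $$ (i, i + b) = 0"
      using band_zero[OF band_mult[OF N(1) Pband], of i "i + b"] i b by simp
    ultimately have "(z * y) $$ (i, i + b) = p i + z $$ (i, i + b)"
      using i b c N Pc by (simp add: y_def N_def P_def)
    then show ?thesis
      using p(2)[of i] by (simp add: add.commute)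
  qed
  define S :: "'k mat" where "S = 1\<^sub>m n + shift n b"
  obtain x1 where x1: "x1 \<in> carrier (TG n)" "S * x1 = x1 * y"
    unfolding S_def using full_superdiagonal_conj[OF b y y_nz] by blast
  obtain x2 where x2: "x2 \<in> carrier (TG n)" "S * x2 = x2 * (z * y)"
    unfolding S_def using full_superdiagonal_conj[OF b zy zy_nz] by blast
  have S: "S \<in> carrier (TG n)"
    unfolding S_def using one_plus_shift_UT[OF b] UT_TG by blast
  let ?G = "TG n :: 'k mat monoid"
  \<comment> \<open>\<open>x1\<close> and \<open>x2\<close> conjugate the same \<open>S\<close> to
    \<open>y\<close> and to \<open>z * y\<close>, so their quotient \<open>g\<close> satisfies
    \<open>g * (z * y) = y * g\<close>.\<close>
  define g where "g = inv\<^bsub>?G\<^esub> x1 \<otimes>\<^bsub>?G\<^esub> x2"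
  have g: "g \<in> carrier ?G"
    using x1 x2 by (simp only: g_def m_closed inv_closed)
  have x1g: "x1 \<otimes>\<^bsub>?G\<^esub> g = x2"
    unfolding g_def using x1(1) x2(1) by (simp only: m_assoc[symmetric] inv_closed r_inv l_one)
  have "x1 \<otimes>\<^bsub>?G\<^esub> (g \<otimes>\<^bsub>?G\<^esub> (z \<otimes>\<^bsub>?G\<^esub> y)) = x2 \<otimes>\<^bsub>?G\<^esub> (z \<otimes>\<^bsub>?G\<^esub> y)"
    using x1(1) g Y Z by (simp only: m_assoc m_closed flip: x1g)
  also have "\<dots> = S \<otimes>\<^bsub>?G\<^esub> (x1 \<otimes>\<^bsub>?G\<^esub> g)"
    using x2(2) x1g by simp
  also have "\<dots> = (S \<otimes>\<^bsub>?G\<^esub> x1) \<otimes>\<^bsub>?G\<^esub> g"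
    using S x1(1) g by (simp only: m_assoc)
  also have "S \<otimes>\<^bsub>?G\<^esub> x1 = x1 \<otimes>\<^bsub>?G\<^esub> y"
    using x1(2) by simp
  also have "(x1 \<otimes>\<^bsub>?G\<^esub> y) \<otimes>\<^bsub>?G\<^esub> g = x1 \<otimes>\<^bsub>?G\<^esub> (y \<otimes>\<^bsub>?G\<^esub> g)"
    using x1(1) Y g by (simp only: m_assoc)
  finally have gzy: "g \<otimes>\<^bsub>?G\<^esub> (z \<otimes>\<^bsub>?G\<^esub> y) = y \<otimes>\<^bsub>?G\<^esub> g"
    using x1(1) g Y Z by (simp only: Units_l_cancel Units_eq m_closed)
  \<comment> \<open>Multiplying \<open>g * (z * y) = y * g\<close> by the inverse \<open>y'\<close>
    of \<open>y\<close> on both sides gives \<open>y' * (g * z) = g * y'\<close>, the relation that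
    \<open>gcommI\<close> asks for.\<close>
  define y' where "y' = inv\<^bsub>?G\<^esub> y"
  have y': "y' \<in> UT n b"
    unfolding y'_def using subgroup.m_inv_closed[OF UT_subgroup y] .
  have Y': "y' \<in> carrier ?G"
    using y' by (rule UT_TG)
  have "y' \<otimes>\<^bsub>?G\<^esub> (g \<otimes>\<^bsub>?G\<^esub> z)
      = y' \<otimes>\<^bsub>?G\<^esub> (g \<otimes>\<^bsub>?G\<^esub> (z \<otimes>\<^bsub>?G\<^esub> y)) \<otimes>\<^bsub>?G\<^esub> y'"
    using Y Y' Z g unfolding y'_def by (simp only: m_assoc m_closed inv_closed r_inv r_one)
  also have "\<dots> = y' \<otimes>\<^bsub>?G\<^esub> y \<otimes>\<^bsub>?G\<^esub> (g \<otimes>\<^bsub>?G\<^esub> y')"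
    unfolding gzy using Y Y' g by (simp only: m_assoc m_closed)
  also have "\<dots> = g \<otimes>\<^bsub>?G\<^esub> y'"
    using Y Y' g unfolding y'_def by (simp only: m_closed inv_closed l_inv l_one)
  finally have "z = gcomm ?G g y'"
    using g Y' Z by (intro gcommI) auto
  with that g y' show ?thesis
    by blast
qed

section \<open>Word values as levels of the filtration, and the width\<close>

text \<open>The diagonal entries of a group element are nonzero, and here 1 is the only nonzero
  scalar.\<close>

lemma UT_0_eq_UT_1:
  assumes "\<And>\<mu> :: 'k :: field. \<mu> = 0 \<or> \<mu> = 1"
  shows "UT n 0 = (UT n 1 :: 'k mat set)"
proof
  show "UT n 0 \<subseteq> (UT n 1 :: 'k mat set)"
  proof
    fix A :: "'k mat" assume "A \<in> UT n 0"
    then have A: "A \<in> carrier (TG n)"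
      by (rule UT_TG)
    show "A \<in> UT n 1"
      using assms TG_diag_nonzero[OF A] by (intro UT_1_I TG_band[OF A]) blast
  qed
qed (rule UT_mono, simp)

text \<open>A third field element makes the diagonal matrices act nontrivially, so that commutators
  with the whole group (\<open>a = 0\<close> or \<open>b = 0\<close>) do not raise the level, except from \<open>0\<close> to \<open>1\<close>;
  over the two-element field \<open>UT n 0 = UT n 1\<close>, and levels add up.\<close>

lemma UT_comm_eq:
  "\<exists>c. {gcomm (TG n) x y | x y. x \<in> UT n a \<and> y \<in> UT n b} = (UT n c :: 'k :: field mat set)"
proof -
  interpret group "TG n :: 'k mat monoid"
    by (rule group_triangular_group)
  let ?C = "\<lambda>a b. {gcomm (TG n) x y | x y. x \<in> UT n a \<and> y \<in> UT n b} :: 'k mat set"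
  have pos: "?C a b = UT n (a + b)" if "1 \<le> a" "1 \<le> b" for a b
    using UT_comm_subset(1) UT_comm_surj[OF that] by blast
  show ?thesis
  proof (cases "\<exists>\<mu> :: 'k. \<mu> \<noteq> 0 \<and> \<mu> \<noteq> 1")
    case True
    then obtain \<mu> :: 'k where \<mu>: "\<mu> \<noteq> 0" "\<mu> \<noteq> 1"
      by blast
    have surj: "UT n b \<subseteq> ?C 0 b" if b: "1 \<le> b" for b
    proof
      fix z :: "'k mat" assume "z \<in> UT n b"
      then obtain x y where "x \<in> carrier (TG n)" "y \<in> UT n b" "z = gcomm (TG n) x y"
        using UT_comm_TG_surj[OF \<mu> b] by blast
      then show "z \<in> ?C 0 b"
        using UT_0 by blast
    qed
    have left: "?C 0 b = UT n b" if "1 \<le> b" for b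
      using UT_comm_subset(1)[of _ n 0 _ b] surj[OF that] by auto
    \<comment> \<open>The inverse of \<open>[x, y]\<close> is \<open>[y, x]\<close> and
      \<open>UT n b\<close> is closed under inverses, so the reverse inclusion follows from
      \<open>surj\<close> applied to the inverse of \<open>z\<close>.\<close>
    have right: "?C b 0 = UT n b" if b: "1 \<le> b" for b
    proof
      show "?C b 0 \<subseteq> UT n b"
        using UT_comm_subset(1)[of _ n b _ 0] by auto
      show "UT n b \<subseteq> ?C b 0"
      proof
        fix z :: "'k mat" assume z: "z \<in> UT n b"
        then have "inv\<^bsub>TG n\<^esub> z \<in> UT n b"
          by (rule subgroup.m_inv_closed[OF UT_subgroup])
        then obtain x y where xy: "x \<in> UT n 0" "y \<in> UT n b" "inv\<^bsub>TG n\<^esub> z = gcomm (TG n) x y"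
          using surj[OF b] by blast
        then have "z = gcomm (TG n) y x"
          using UT_TG[OF z] UT_TG[of x] UT_TG[of y] by (metis inv_gcomm inv_inv)
        with xy show "z \<in> ?C b 0"
          by blast
      qed
    qed
    have both: "?C 0 0 = UT n 1"
    proof
      show "?C 0 0 \<subseteq> UT n 1"
        using UT_comm_subset(2) by blast
      \<comment> \<open>Already the commutators with \<open>y\<close> in \<open>UT n 1\<close> fill
        up this level.\<close>
      show "UT n 1 \<subseteq> ?C 0 0"
        using surj[of 1] UT_mono[of 0 1 n] by blast
    qed
    consider "a = 0" "b = 0" | "a = 0" "1 \<le> b" | "1 \<le> a" "b = 0" | "1 \<le> a" "1 \<le> b"
      by linarith
    then show ?thesis
    proof cases
      case 1
      show ?thesis
        unfolding 1 by (rule exI, rule both)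
    next
      case 2
      show ?thesis
        unfolding 2(1) by (rule exI, rule left, rule 2(2))
    next
      case 3
      show ?thesis
        unfolding 3(2) by (rule exI, rule right, rule 3(1))
    next
      case 4
      show ?thesis
        by (rule exI, rule pos[OF 4])
    qed
  next
    case False
    then have eq: "UT n 0 = (UT n 1 :: 'k mat set)"
      by (intro UT_0_eq_UT_1) blast
    \<comment> \<open>Replacing level 0 by level 1 brings every case under
      \<open>pos\<close>.\<close>
    have max1: "(UT n a :: 'k mat set) = UT n (max a 1)" for a
    proof (cases a)
      case 0
      then show ?thesis
        by (simp only: eq max_0L)
    next
      case (Suc a')
      then have "max a 1 = a"
        by simp
      then show ?thesis
        by (simp only:)
    qed
    show ?thesis
      unfolding max1[of a] max1[of b] by (rule exI, rule pos) (rule max.cobounded2)+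
  qed
qed

lemma word_values_TG:
  assumes "commutator_bracketing xs w" "distinct xs"
  shows "\<exists>d. word_values (TG n) w = (UT n d :: 'k :: field mat set)"
  using assms
proof (induction rule: commutator_bracketing.induct)
  case (variable x)
  interpret group "TG n :: 'k mat monoid"
    by (rule group_triangular_group)
  show ?case
    using word_values_variable UT_0 by blast
next
  case (commutator xs u ys v)
  interpret group "TG n :: 'k mat monoid"
    by (rule group_triangular_group)
  obtain a b where ab: "word_values (TG n) u = (UT n a :: 'k mat set)"
    "word_values (TG n) v = (UT n b :: 'k mat set)"
    using commutator by auto
  have "fst ` set u \<inter> fst ` set v = {}"
    using commutator.prems commutator.hyps[THEN vars_commutator_bracketing] by simp
  then have eq: "word_values (TG n) (word_comm u v)
      = {gcomm (TG n) x y | x y. x \<in> UT n a \<and> y \<in> (UT n b :: 'k mat set)}"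
    unfolding ab[symmetric] by (rule word_values_comm)
  show ?case
    unfolding eq by (rule UT_comm_eq)
qed

theorem theorem3:
  fixes w :: gword and n :: nat
  assumes "outer_commutator_word w" and "n \<ge> 2"
  shows "wid (triangular_group TYPE('k :: field) n) w = 1"
proof -
  interpret group "TG n :: 'k mat monoid"
    by (rule group_triangular_group)
  obtain d where "word_values (TG n) w = (UT n d :: 'k mat set)"
    using assms(1) word_values_TG unfolding outer_commutator_word_def by blast
  then show ?thesis
    using wid_eq_1 UT_subgroup by metis
qed

end
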